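(* Let $t,\alpha,\beta\ge0$. Then for all $f:S\to\mathbb R$ with $\int f\,d\mu_t=0$ the following hold. (i) If $\lambda_s\ge\frac12A_s+\alpha C_s$ for all $s\in[0,t]$, then for all $s\in[0,t]$ $$\|q_{s,t}f\|_{L^2(\mu_s)}\le e^{-\alpha(t-s)}\,\|f\|_{L^2(\mu_t)}.$$ (ii) If $p=2^n$ for some integer $n\ge1$ and $$\lambda_s\ \ge\ \frac p4A_s+\beta\,\frac{p-1}4B_s+\alpha\,\frac p2C_s\qquad\text{for all } s\in[0,t],$$ then for all $s\in[0,t]$ $$\|q_{s,t}f\|_{L^p(\mu_s)}\le e^{-\alpha(t-s)}\sqrt{2+(\alpha\beta)^{-1}}\;\|f\|_{L^p(\mu_t)},$$ where $(\alpha\beta)^{-1}:=+\infty$ if $\alpha\beta=0$.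
   Context: **Setting.** $S$ is a finite set. For $t\ge0$, $\mu_t(x)=\frac1{Z_t}e^{-\mathcal H_t(x)}\mu_0(x)$ are probability measures on $S$ with $\mu_t(x)>0$ for all $x\in S$, where $Z_t$ is a normalization constant and $(t,x)\mapsto\mathcal H_t(x)$ is a function on $[0,\infty)\times S$ that is continuously differentiable in $t$. Put $$H_t(x):=-\frac{\partial}{\partial t}\log\mu_t(x)=\frac{\partial}{\partial t}\mathcal H_t(x)-\int\frac{\partial}{\partial t}\mathcal H_t\,d\mu_t .$$ For each $t\ge0$, $\mathcal L_t=(\mathcal L_t(x,y))_{x,y\in S}$ is a $Q$-matrix (off-diagonal entries $\ge0$, row sums $0$), continuous in $t$, satisfying detailed balance $\mu_t(x)\mathcal L_t(x,y)=\mu_t(y)\mathcal L_t(y,x)$ for all $x,y\in S$; $(\mathcal L_tf)(x)=\sum_y\mathcal L_t(x,y)f(y)$. A continuous function $t\mapsto\lambda_t\in(0,\infty)$ is fixed. For $0\le s\le t$ and $f:S\to\mathbb R$, $q_{s,t}f:S\to\mathbb R$ is the unique solution of the backward equation $$-\frac{\partial}{\partial s}q_{s,t}f=\lambda_s\mathcal L_sq_{s,t}f-H_s\,q_{s,t}f,\quad s\in[0,t],\qquad q_{t,t}f=f.$$ **Norms.** $\|f\|_{L^p(\mu)}=\big(\sum_x|f(x)|^p\mu(x)\big)^{1/p}$. **Constants.** The Dirichlet form is $\mathcal E_t(f)=-\int f\,\mathcal L_tf\,d\mu_t=\frac12\sum_{x,y}(f(y)-f(x))^2\mathcal L_t(x,y)\mu_t(x)$.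 With $\mathcal K_t=\{f:S\to\mathbb R:\int f\,d\mu_t=0,\ f\not\equiv0\}$, set $$A_t:=\sup_{f\in\mathcal K_t}\frac{\int(-H_t)f^2\,d\mu_t}{\mathcal E_t(f)},\qquad B_t:=\sup_{f\in\mathcal K_t}\frac{|\int H_tf\,d\mu_t|^2}{\mathcal E_t(f)},\qquad C_t:=\sup_{f\in\mathcal K_t}\frac{\int f^2\,d\mu_t}{\mathcal E_t(f)},$$ i.e. the optimal constants in $-\int H_t(f-\int f\,d\mu_t)^2d\mu_t\le A_t\mathcal E_t(f)$, $|\int H_tf\,d\mu_t|^2\le B_t\mathcal E_t(f)$ and $\mathrm{Var}_{\mu_t}(f)\le C_t\mathcal E_t(f)$ for all $f:S\to\mathbb R$. These may be infinite. Conventions for degenerate cases: $a/0=+\infty,\,0,\,-\infty$ according to $a>0$, $a=0$, $a<0$; $\sup\emptyset=0$; $0\cdot\infty=0$; $-\infty+\infty=+\infty$; an assumed inequality fails if its right-hand side is $+\infty$. *)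

theory Defs
  imports "HOL-Probability.Probability"
begin

definition normalization :: "(real \<Rightarrow> 'a::finite pmf) \<Rightarrow> (real \<Rightarrow> 'a \<Rightarrow> real) \<Rightarrow> real \<Rightarrow> real" where
  "normalization mu Ham t = (\<Sum>x\<in>UNIV. exp (- Ham t x) * pmf (mu 0) x)"

definition gen :: "('a::finite \<Rightarrow> 'a \<Rightarrow> real) \<Rightarrow> ('a \<Rightarrow> real) \<Rightarrow> 'a \<Rightarrow> real" where
  "gen Q f x = (\<Sum>y\<in>UNIV. Q x y * f y)"

text \<open>
  The finite set $S$ is the universe of the type \<open>'a\<close>, \<open>Ham\<close> is the family
  $(\mathcal H_t)_{t \ge 0}$, \<open>L\<close> the family of $Q$-matrices and \<open>lam\<close> the function
  $t \mapsto \lambda_t$.  Only times $t \ge 0$ matter; derivatives at time $0$ are one-sided.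
\<close>

locale evolving_measures =
  fixes mu :: "real \<Rightarrow> 'a::finite pmf"
    and Ham :: "real \<Rightarrow> 'a \<Rightarrow> real"
    and L :: "real \<Rightarrow> 'a \<Rightarrow> 'a \<Rightarrow> real"
    and lam :: "real \<Rightarrow> real"
  assumes mu_pos: "\<And>t x. 0 \<le> t \<Longrightarrow> 0 < pmf (mu t) x"
    and mu_eq: "\<And>t x. 0 \<le> t \<Longrightarrow>
      pmf (mu t) x = 1 / normalization mu Ham t * exp (- Ham t x) * pmf (mu 0) x"
    and Ham_C1: "\<And>x. \<exists>D. continuous_on {0..} D \<and>
      (\<forall>t\<ge>0. ((\<lambda>r. Ham r x) has_real_derivative D t) (at t within {0..}))"
    and L_nonneg: "\<And>t x y. 0 \<le> t \<Longrightarrow> x \<noteq> y \<Longrightarrow> 0 \<le> L t x y"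
    and L_row_sum: "\<And>t x. 0 \<le> t \<Longrightarrow> (\<Sum>y\<in>UNIV. L t x y) = 0"
    and L_cont: "\<And>x y. continuous_on {0..} (\<lambda>t. L t x y)"
    and detailed_balance: "\<And>t x y. 0 \<le> t \<Longrightarrow> pmf (mu t) x * L t x y = pmf (mu t) y * L t y x"
    and lam_pos: "\<And>t. 0 \<le> t \<Longrightarrow> 0 < lam t"
    and lam_cont: "continuous_on {0..} lam"

definition neg_log_deriv :: "(real \<Rightarrow> 'a::finite pmf) \<Rightarrow> real \<Rightarrow> 'a \<Rightarrow> real" where
  "neg_log_deriv mu t x = - vector_derivative (\<lambda>r. ln (pmf (mu r) x)) (at t within {0..})"

lemma expectation_finite:
  fixes p :: "'a::finite pmf" and f :: "'a \<Rightarrow> real"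
  shows "measure_pmf.expectation p f = (\<Sum>x\<in>UNIV. f x * pmf p x)"
  by (rule integral_measure_pmf_real) auto

lemma (in evolving_measures) neg_log_deriv_eq:
  assumes t: "0 \<le> t"
    and D: "\<And>x. ((\<lambda>r. Ham r x) has_real_derivative D x) (at t within {0..})"
  shows "neg_log_deriv mu t x = D x - measure_pmf.expectation (mu t) D"
proof -
  let ?Z = "normalization mu Ham"
  have Z_pos: "0 < ?Z r" for r
    unfolding normalization_def using mu_pos[of 0] by (intro sum_pos) auto
  have ln_eq: "ln (pmf (mu r) x) = - ln (?Z r) - Ham r x + ln (pmf (mu 0) x)" if "r \<in> {0..}" for r
    using that mu_eq[of r x] mu_pos[of 0 x] Z_pos[of r]
    by (simp add: ln_mult ln_div)
  have dZ: "(?Z has_real_derivative (\<Sum>y\<in>UNIV. - D y * exp (- Ham t y) * pmf (mu 0) y))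
      (at t within {0..})"
    unfolding normalization_def[abs_def]
    by (rule DERIV_cong, (rule derivative_intros D)+) (simp add: sum_negf algebra_simps)
  have sum_eq: "(\<Sum>y\<in>UNIV. - D y * exp (- Ham t y) * pmf (mu 0) y) / ?Z t
      = - measure_pmf.expectation (mu t) D"
    unfolding expectation_finite mu_eq[OF t]
    by (simp add: sum_negf sum_divide_distrib mult.assoc)
  have "((\<lambda>r. - ln (?Z r) - Ham r x + ln (pmf (mu 0) x)) has_real_derivative
      - (inverse (?Z t) * (\<Sum>y\<in>UNIV. - D y * exp (- Ham t y) * pmf (mu 0) y)) - D x + 0)
      (at t within {0..})"
    by (intro derivative_intros DERIV_chain2[OF DERIV_ln] Z_pos dZ D)
  moreover have "- (inverse (?Z t) * (\<Sum>y\<in>UNIV. - D y * exp (- Ham t y) * pmf (mu 0) y)) - D x + 0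
      = measure_pmf.expectation (mu t) D - D x"
    using sum_eq by (simp add: field_simps)
  ultimately have "((\<lambda>r. - ln (?Z r) - Ham r x + ln (pmf (mu 0) x)) has_real_derivative
      measure_pmf.expectation (mu t) D - D x) (at t within {0..})"
    by simp
  then have "((\<lambda>r. ln (pmf (mu r) x)) has_real_derivative
      measure_pmf.expectation (mu t) D - D x) (at t within {0..})"
    by (rule has_field_derivative_transform_within[where d = 1]) (use t in \<open>simp_all only: ln_eq[symmetric], simp_all\<close>)
  then have "((\<lambda>r. ln (pmf (mu r) x)) has_vector_derivative
      measure_pmf.expectation (mu t) D - D x) (at t within {0..})"
    by (simp add: has_real_derivative_iff_has_vector_derivative)
  moreover have "at t within {0..} \<noteq> bot"
  proof
    assume "at t within {0..} = bot"
    moreover have "at_right t \<le> at t within {0..}"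
      using t by (intro at_le) auto
    ultimately show False
      by (simp add: bot_unique)
  qed
  ultimately show ?thesis
    unfolding neg_log_deriv_def by (simp add: vector_derivative_within)
qed

text \<open>
  \<open>u\<close> is the function $s \mapsto q_{s,t} f$ on $[0,t]$; its values outside $[0,t]$ are irrelevant.
\<close>

definition backward_solution ::
  "(real \<Rightarrow> 'a::finite pmf) \<Rightarrow> (real \<Rightarrow> 'a \<Rightarrow> 'a \<Rightarrow> real) \<Rightarrow> (real \<Rightarrow> real) \<Rightarrow>
    real \<Rightarrow> ('a \<Rightarrow> real) \<Rightarrow> (real \<Rightarrow> 'a \<Rightarrow> real) \<Rightarrow> bool" where
  "backward_solution mu L lam t f u \<longleftrightarrow>
    (\<forall>s\<in>{0..t}. \<forall>x. ((\<lambda>r. u r x) has_real_derivative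
        - (lam s * gen (L s) (u s) x - neg_log_deriv mu s x * u s x)) (at s within {0..t})) \<and>
    u t = f"

definition Lp_norm :: "real \<Rightarrow> 'a::finite pmf \<Rightarrow> ('a \<Rightarrow> real) \<Rightarrow> real" where
  "Lp_norm p m f = (\<Sum>x\<in>UNIV. \<bar>f x\<bar> powr p * pmf m x) powr (1 / p)"

definition dirichlet ::
  "(real \<Rightarrow> 'a::finite pmf) \<Rightarrow> (real \<Rightarrow> 'a \<Rightarrow> 'a \<Rightarrow> real) \<Rightarrow> real \<Rightarrow> ('a \<Rightarrow> real) \<Rightarrow> real" where
  "dirichlet mu L t f = - measure_pmf.expectation (mu t) (\<lambda>x. f x * gen (L t) f x)"

definition centered :: "'a::finite pmf \<Rightarrow> ('a \<Rightarrow> real) set" where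
  "centered m = {f. measure_pmf.expectation m f = 0 \<and> f \<noteq> (\<lambda>_. 0)}"

text \<open>
  The conventions for degenerate cases are those of \<^typ>\<open>ereal\<close>: \<open>a / 0\<close> is \<open>\<infinity>\<close>, \<open>0\<close> or
  \<open>- \<infinity>\<close> according to the sign of \<open>a\<close>, \<open>0 * \<infinity> = 0\<close> and \<open>- \<infinity> + \<infinity> = \<infinity>\<close>.  The only exception
  is the supremum of the empty set, which occurs when $S$ has a single point.
\<close>

lemma ereal_conventions:
  fixes a :: real
  shows "ereal a / 0 = (if 0 < a then \<infinity> else if a = 0 then 0 else - \<infinity>)"
    and "(0::ereal) * \<infinity> = 0" and "- \<infinity> + \<infinity> = (\<infinity>::ereal)" and "\<infinity> + - \<infinity> = (\<infinity>::ereal)"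
  by (auto simp: divide_ereal_def)

definition Sup0 :: "ereal set \<Rightarrow> ereal" where
  "Sup0 X = (if X = {} then 0 else Sup X)"

definition const_A ::
  "(real \<Rightarrow> 'a::finite pmf) \<Rightarrow> (real \<Rightarrow> 'a \<Rightarrow> 'a \<Rightarrow> real) \<Rightarrow> real \<Rightarrow> ereal" where
  "const_A mu L t = Sup0 ((\<lambda>f.
      ereal (measure_pmf.expectation (mu t) (\<lambda>x. - neg_log_deriv mu t x * (f x)\<^sup>2)) /
      ereal (dirichlet mu L t f)) ` centered (mu t))"

definition const_B ::
  "(real \<Rightarrow> 'a::finite pmf) \<Rightarrow> (real \<Rightarrow> 'a \<Rightarrow> 'a \<Rightarrow> real) \<Rightarrow> real \<Rightarrow> ereal" where
  "const_B mu L t = Sup0 ((\<lambda>f.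
      ereal (\<bar>measure_pmf.expectation (mu t) (\<lambda>x. neg_log_deriv mu t x * f x)\<bar>\<^sup>2) /
      ereal (dirichlet mu L t f)) ` centered (mu t))"

definition const_C ::
  "(real \<Rightarrow> 'a::finite pmf) \<Rightarrow> (real \<Rightarrow> 'a \<Rightarrow> 'a \<Rightarrow> real) \<Rightarrow> real \<Rightarrow> ereal" where
  "const_C mu L t = Sup0 ((\<lambda>f.
      ereal (measure_pmf.expectation (mu t) (\<lambda>x. (f x)\<^sup>2)) /
      ereal (dirichlet mu L t f)) ` centered (mu t))"

definition ereal_sqrt :: "ereal \<Rightarrow> ereal" where
  "ereal_sqrt x = (case x of ereal r \<Rightarrow> ereal (sqrt r) | PInfty \<Rightarrow> \<infinity> | MInfty \<Rightarrow> - \<infinity>)"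

end

theory Submission
  imports Defs
begin

text \<open>
  Write \<open>H\<close> for \<open>neg_log_deriv mu s\<close>, \<open>u\<close> for the solution, \<open>p = 2k\<close> and \<open>F\<close>, \<open>F2\<close> for the
  integrals of \<open>u ^ p\<close>, \<open>u\<^sup>2\<close> under \<open>mu s\<close>, and put \<open>m = \<integral> u ^ k\<close>.  Differentiating in \<open>s\<close> and using the
  Stroock-Varopoulos inequality gives
  \<open>F' \<ge> (p - 1) * (4 / p * lam s * E (u ^ k) + \<integral> H * u ^ p)\<close>, while the integral of \<open>u\<close> stays \<open>0\<close>.  For
  \<open>p = 2\<close> this is \<open>F' \<ge> 2 * \<alpha> * F\<close>.  For larger \<open>p\<close> one applies the bounds to \<open>u ^ k - m\<close>; since
  \<open>\<integral> H = 0\<close>, completing the square in \<open>\<integral> H * u ^ k\<close> leaves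
  \<open>F' \<ge> 2 * \<alpha> * (p - 1) * (F - m\<^sup>2) - p / \<beta> * m\<^sup>2\<close>.
  Going from \<open>p / 2\<close> to \<open>p\<close> by induction loses too much in the constant.  Instead \<open>m\<close> is
  interpolated between \<open>F2\<close>, whose decay is already known, and \<open>F\<close>; then
  \<open>(2 + 1 / (\<alpha> * \<beta>)) ^ k * exp (- p * \<alpha> * (t - s)) * \<integral> f ^ p\<close> is a barrier for \<open>F\<close>, the constant being
  just large enough because \<open>ln D \<ge> 1 - 1 / D\<close>.
\<close>

section \<open>Elementary inequalities: Gronwall, Stroock-Varopoulos, Young, Hoelder\<close>

text \<open>The product \<open>exp (- c * r) * Y r\<close> is nondecreasing. Below,
  \<open>c = 0\<close> gives conservation of the mean, and \<open>Y\<close> may be a difference that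
  is to be shown nonpositive.\<close>

lemma gronwall_backward:
  fixes Y Y' :: "real \<Rightarrow> real"
  assumes deriv: "\<And>s. s \<in> {0..t} \<Longrightarrow> (Y has_real_derivative Y' s) (at s within {0..t})"
    and ge: "\<And>s. s \<in> {0..t} \<Longrightarrow> c * Y s \<le> Y' s"
    and s: "s \<in> {0..t}"
  shows "Y s \<le> exp (- c * (t - s)) * Y t"
proof (cases "s = t")
  case False
  define Z where "Z r = exp (- c * r) * Y r" for r
  have Z: "(Z has_real_derivative exp (- c * r) * (Y' r - c * Y r)) (at r within {s..t})"
    if "r \<in> {s..t}" for r
  proof -
    have "(Y has_real_derivative Y' r) (at r within {s..t})"
      using that s by (intro DERIV_subset[OF deriv]) auto
    then show ?thesis
      unfolding Z_def[abs_def]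
      by (auto intro!: derivative_eq_intros simp: algebra_simps)
  qed
  obtain r where r: "r \<in> {s<..<t}" and "Z t - Z s = exp (- c * r) * (Y' r - c * Y r) * (t - s)"
    using mvt_simple[of s t Z "\<lambda>r. (*) (exp (- c * r) * (Y' r - c * Y r))"] Z s False
    by (auto simp: has_field_derivative_def)
  moreover have "0 \<le> exp (- c * r) * (Y' r - c * Y r) * (t - s)"
    using ge[of r] r s by (intro mult_nonneg_nonneg) auto
  ultimately have "Z s \<le> Z t"
    by simp
  then have "exp (c * s) * Z s \<le> exp (c * s) * Z t"
    by simp
  moreover have "exp (c * s) * Z s = Y s"
    by (simp add: Z_def exp_minus)
  moreover have "exp (c * s) * Z t = exp (- c * (t - s)) * Y t"
    unfolding Z_def mult.assoc[symmetric] exp_add[symmetric] by (simp add: algebra_simps)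
  ultimately show ?thesis by simp
qed simp

text \<open>
  Integrating \<open>(x ^ (k - 1) - \<mu>)\<^sup>2 \<ge> 0\<close> over \<open>[b, a]\<close> with the optimal \<open>\<mu>\<close> avoids any
  case distinction on the signs of \<open>a\<close> and \<open>b\<close>.
\<close>

lemma stroock_varopoulos:
  fixes a b :: real
  assumes k: "1 \<le> k"
  shows "real (2 * k - 1) * (a ^ k - b ^ k)\<^sup>2
    \<le> (real k)\<^sup>2 * ((a - b) * (a ^ (2 * k - 1) - b ^ (2 * k - 1)))"
proof -
  have flip: "real (2 * k - 1) * (a ^ k - b ^ k)\<^sup>2
    \<le> (real k)\<^sup>2 * ((a - b) * (a ^ (2 * k - 1) - b ^ (2 * k - 1)))" if "b < a" for a b :: real
  proof -
    define P Q R K J where "P = a ^ (2 * k - 1) - b ^ (2 * k - 1)" and "Q = a ^ k - b ^ k"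
      and "R = a - b" and "K = real k" and "J = real (2 * k - 1)"
    have pos: "0 < R" "0 < K" "0 < J"
      using that k by (auto simp: R_def K_def J_def)
    \<comment> \<open>The average of \<open>x ^ (k - 1)\<close> over the interval from
      \<open>b\<close> to \<open>a\<close>, which minimises the integral of the square.\<close>
    define \<mu> where "\<mu> = Q / (K * R)"
    define \<psi> where "\<psi> x = inverse J * x ^ (2 * k - 1) - 2 * \<mu> * inverse K * x ^ k + \<mu>\<^sup>2 * x"
      for x :: real
    have "(\<psi> has_real_derivative (x ^ (k - 1) - \<mu>)\<^sup>2) (at x)" for x
    proof -
      have "(\<psi> has_real_derivative inverse J * (J * x ^ (2 * k - 1 - Suc 0))
          - 2 * \<mu> * inverse K * (K * x ^ (k - Suc 0)) + \<mu>\<^sup>2 * 1) (at x)"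
        unfolding \<psi>_def[abs_def] J_def K_def
        by (intro DERIV_add DERIV_diff DERIV_cmult DERIV_pow DERIV_ident)
      moreover have "x ^ (2 * k - 1 - Suc 0) = (x ^ (k - 1))\<^sup>2"
      proof -
        have "2 * k - 1 - Suc 0 = (k - 1) * 2" by simp
        then show ?thesis by (simp only: power_mult)
      qed
      moreover have "inverse J * (J * y) - 2 * \<mu> * inverse K * (K * z) + \<mu>\<^sup>2 * 1
          = y - 2 * \<mu> * z + \<mu>\<^sup>2" for y z
        using pos by (simp add: field_simps)
      ultimately show ?thesis
        by (simp only: power2_diff) (simp add: algebra_simps)
    qed
    then have "\<psi> b \<le> \<psi> a"
      using that by (intro DERIV_nonneg_imp_nondecreasing[of b a \<psi>]) (auto intro: zero_le_power2)
    then have "0 \<le> P / J - 2 * \<mu> * Q / K + \<mu>\<^sup>2 * R"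
      by (simp add: \<psi>_def P_def Q_def R_def divide_inverse algebra_simps)
    then have "0 \<le> P / J - Q\<^sup>2 / (K\<^sup>2 * R)"
      using pos by (simp add: \<mu>_def field_simps power2_eq_square)
    then have "Q\<^sup>2 / (K\<^sup>2 * R) \<le> P / J"
      by simp
    then have "J * Q\<^sup>2 \<le> K\<^sup>2 * (R * P)"
      using pos by (simp add: field_simps)
    then show ?thesis
      by (simp add: P_def Q_def R_def K_def J_def)
  qed
  show ?thesis
  proof (cases a b rule: linorder_cases)
    case less
    then show ?thesis
      using flip[OF less] power2_commute[of "a ^ k" "b ^ k"]
        minus_mult_minus[of "a - b" "a ^ (2 * k - 1) - b ^ (2 * k - 1)"]
      by (simp only: minus_diff_eq)
  next
    case equal
    then show ?thesis by simp
  next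
    case greater
    then show ?thesis by (rule flip)
  qed
qed

lemma young_powr:
  fixes a b :: real
  assumes "0 \<le> l" "0 \<le> m" "l + m = 1" "0 \<le> a" "0 \<le> b"
  shows "a powr l * b powr m \<le> l * a + m * b"
proof (cases "a = 0 \<or> b = 0")
  case True
  then show ?thesis using assms by auto
next
  case False
  then show ?thesis using assms by (intro Youngs_inequality_0) auto
qed

text \<open>After both sums are normalised to 1, weighted AM-GM applies termwise and the bounds add
  up to \<open>l + m = 1\<close>. If one sum vanishes, so does every term on the left. This is
  Hoelder's inequality with exponents \<open>1 / l\<close> and \<open>1 / m\<close>.\<close>

lemma holder_sum:
  fixes w a b :: "'a \<Rightarrow> real"
  assumes "finite I" and w: "\<And>i. i \<in> I \<Longrightarrow> 0 \<le> w i"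
    and a: "\<And>i. i \<in> I \<Longrightarrow> 0 \<le> a i" and b: "\<And>i. i \<in> I \<Longrightarrow> 0 \<le> b i"
    and l: "0 \<le> l" "0 \<le> m" "l + m = 1"
  shows "(\<Sum>i\<in>I. a i powr l * b i powr m * w i) \<le> (\<Sum>i\<in>I. a i * w i) powr l * (\<Sum>i\<in>I. b i * w i) powr m"
proof -
  define A B where "A = (\<Sum>i\<in>I. a i * w i)" and "B = (\<Sum>i\<in>I. b i * w i)"
  have nonneg: "0 \<le> A" "0 \<le> B"
    using a b w by (auto simp: A_def B_def intro!: sum_nonneg)
  consider "A = 0" | "B = 0" | "0 < A" "0 < B"
    using nonneg by linarith
  then show ?thesis
  proof cases
    case 1
    then have "\<forall>i\<in>I. a i = 0 \<or> w i = 0"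
      using a w \<open>finite I\<close> by (simp add: A_def sum_nonneg_eq_0_iff)
    then have "(\<Sum>i\<in>I. a i powr l * b i powr m * w i) = 0"
      by (intro sum.neutral) auto
    then show ?thesis by simp
  next
    case 2
    then have "\<forall>i\<in>I. b i = 0 \<or> w i = 0"
      using b w \<open>finite I\<close> by (simp add: B_def sum_nonneg_eq_0_iff)
    then have "(\<Sum>i\<in>I. a i powr l * b i powr m * w i) = 0"
      by (intro sum.neutral) auto
    then show ?thesis by simp
  next
    case 3
    have "(\<Sum>i\<in>I. a i powr l * b i powr m * w i)
        \<le> (\<Sum>i\<in>I. (A powr l * B powr m) * ((l / A) * (a i * w i) + (m / B) * (b i * w i)))"
    proof (rule sum_mono)
      fix i assume i: "i \<in> I"
      have "a i powr l * b i powr m = (A powr l * B powr m) * ((a i / A) powr l * (b i / B) powr m)"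
        using 3 a[OF i] b[OF i] by (simp add: powr_divide)
      also have "\<dots> \<le> (A powr l * B powr m) * (l * (a i / A) + m * (b i / B))"
        using 3 a[OF i] b[OF i] l by (intro mult_left_mono young_powr) auto
      finally have "a i powr l * b i powr m * w i
          \<le> (A powr l * B powr m) * (l * (a i / A) + m * (b i / B)) * w i"
        using w[OF i] by (rule mult_right_mono)
      then show "a i powr l * b i powr m * w i
          \<le> (A powr l * B powr m) * ((l / A) * (a i * w i) + (m / B) * (b i * w i))"
        by (simp add: algebra_simps)
    qed
    also have "\<dots> = (A powr l * B powr m) * ((l / A) * A + (m / B) * B)"
      unfolding A_def B_def by (simp only: sum.distrib flip: sum_distrib_left)
    also have "\<dots> = A powr l * B powr m"
      using 3 l by simp
    finally show ?thesis
      by (simp add: A_def B_def)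
  qed
qed

text \<open>With \<open>D = 2 + x\<close> the left side is exactly \<open>k * D - 1\<close>. On the
  right, \<open>D powr (k / (k - 1)) = D * exp (ln D / (k - 1))\<close>, and
  \<open>exp y \<ge> 1 + y\<close> followed by \<open>ln D \<ge> 1 - 1 / D\<close> suffices. It is
  applied with \<open>x = 1 / (\<alpha> * \<beta>)\<close>.\<close>

lemma exponent_constant_bound:
  fixes x :: real
  assumes x: "0 \<le> x" and k: "2 \<le> k"
  shows "real (2 * k - 1) + real k * x \<le> (real k - 1) * (2 + x) powr (real k / (real k - 1))"
proof -
  define D where "D = 2 + x"
  have D: "0 < D" using x by (simp add: D_def)
  have k1: "0 < real k - 1" using k by simp
  have "1 - 1 / D \<le> ln D"
    using ln_le_minus_one[of "inverse D"] D by (simp add: ln_inverse divide_inverse)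
  then have "D * (1 + (1 - 1 / D) / (real k - 1)) \<le> D * (1 + ln D / (real k - 1))"
    using D k1 by (intro mult_left_mono add_left_mono divide_right_mono) auto
  also have "\<dots> \<le> D * exp (ln D / (real k - 1))"
    using D by (intro mult_left_mono exp_ge_add_one_self) auto
  also have "\<dots> = D powr (1 + 1 / (real k - 1))"
    using D by (simp add: powr_add) (simp add: powr_def)
  also have "1 + 1 / (real k - 1) = real k / (real k - 1)"
    using k1 by (simp add: field_simps)
  finally have "(real k - 1) * (D * (1 + (1 - 1 / D) / (real k - 1)))
      \<le> (real k - 1) * D powr (real k / (real k - 1))"
    using k1 by simp
  moreover have "(real k - 1) * (D * (1 + (1 - 1 / D) / (real k - 1))) = real (2 * k - 1) + real k * x"
  proof -
    have "(real k - 1) * (D * (1 + (1 - 1 / D) / (real k - 1))) = (real k - 1) * D + D * (1 - 1 / D)"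
      using k1 by (simp add: field_simps)
    also have "\<dots> = real k * D - 1"
      using D by (simp add: field_simps)
    finally show ?thesis
      using k by (simp add: D_def algebra_simps of_nat_diff)
  qed
  ultimately show ?thesis by (simp add: D_def)
qed

section \<open>Dirichlet form, optimal constants and the derivative of the measures\<close>

abbreviation mean :: "'a::finite pmf \<Rightarrow> ('a \<Rightarrow> real) \<Rightarrow> real" where
  "mean m f \<equiv> \<Sum>x\<in>UNIV. f x * pmf m x"

lemma sum_pmf_UNIV [simp]: "sum (pmf m) UNIV = 1" for m :: "'a::finite pmf"
  by (rule sum_pmf_eq_1) auto

lemma mean_const [simp]: "mean m (\<lambda>_. c) = c"
  by (simp add: sum_distrib_left[symmetric])

text \<open>For \<open>E \<noteq> 0\<close> this is multiplication by \<open>E\<close>. For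
  \<open>E = 0\<close> a positive numerator with positive coefficient contributes
  \<open>\<infinity>\<close>, which a \<open>- \<infinity>\<close> from \<open>n1\<close> cannot
  cancel since their sum is \<open>\<infinity>\<close>. The finite bound \<open>l\<close> therefore
  forces \<open>n1 \<le> 0\<close> and kills the other two products.\<close>

lemma ratio_bound:
  fixes n1 n2 n3 E l c1 c2 c3 :: real
  assumes l: "ereal c1 * (ereal n1 / ereal E) + ereal c2 * (ereal n2 / ereal E)
      + ereal c3 * (ereal n3 / ereal E) \<le> ereal l"
    and E: "0 \<le> E" and n: "0 \<le> n2" "0 \<le> n3" and c: "0 < c1" "0 \<le> c2" "0 \<le> c3"
  shows "c1 * n1 + c2 * n2 + c3 * n3 \<le> l * E"
proof (cases "E = 0")
  case False
  then have "c1 * (n1 / E) + c2 * (n2 / E) + c3 * (n3 / E) \<le> l"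
    using l by simp
  then show ?thesis
    using False E by (simp add: field_simps)
next
  case True
  note zero = l[unfolded True zero_ereal_def[symmetric]]
  have "n1 \<le> 0"
  proof (rule ccontr)
    assume "\<not> n1 \<le> 0"
    then show False
      using zero n c by (auto simp: divide_ereal_def)
  qed
  moreover have "c2 * n2 = 0"
  proof (rule ccontr)
    assume "c2 * n2 \<noteq> 0"
    then show False
      using zero n c by (auto simp: divide_ereal_def)
  qed
  moreover have "c3 * n3 = 0"
  proof (rule ccontr)
    assume "c3 * n3 \<noteq> 0"
    then show False
      using zero n c by (auto simp: divide_ereal_def)
  qed
  moreover have "c1 * n1 \<le> 0"
    using c \<open>n1 \<le> 0\<close> by (simp add: mult_nonneg_nonpos)
  ultimately have "c1 * n1 + c2 * n2 + c3 * n3 \<le> 0"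
    by linarith
  then show ?thesis
    by (simp add: True)
qed

context evolving_measures
begin

text \<open>The bilinear form behind the Dirichlet form. Two arguments are needed because
  differentiating a moment pairs a power of \<open>u\<close> with \<open>u\<close> itself.\<close>

definition energy :: "real \<Rightarrow> ('a \<Rightarrow> real) \<Rightarrow> ('a \<Rightarrow> real) \<Rightarrow> real" where
  "energy s f g = - mean (mu s) (\<lambda>x. f x * gen (L s) g x)"

lemma dirichlet_eq_energy: "dirichlet mu L s f = energy s f f"
  by (simp add: dirichlet_def energy_def expectation_finite)

text \<open>Expanding the product, the terms in \<open>x\<close> alone or \<open>y\<close> alone
  vanish by the zero row sums and the symmetry of the weights; by the same symmetry (detailed
  balance) the two cross terms agree.\<close>

lemma energy_eq:
  assumes s: "0 \<le> s"
  shows "energy s f g = (\<Sum>x\<in>UNIV. \<Sum>y\<in>UNIV. (f x - f y) * (g x - g y) * (pmf (mu s) x * L s x y)) / 2"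
proof -
  define W where "W x y = pmf (mu s) x * L s x y" for x y
  have row: "(\<Sum>y\<in>UNIV. W x y) = 0" for x
    unfolding W_def sum_distrib_left[symmetric] L_row_sum[OF s] by simp
  have sym: "W x y = W y x" for x y
    unfolding W_def by (rule detailed_balance[OF s])
  have diag: "(\<Sum>x\<in>UNIV. \<Sum>y\<in>UNIV. h x * W x y) = 0" for h :: "'a \<Rightarrow> real"
    by (simp add: sum_distrib_left[symmetric] row)
  have diag': "(\<Sum>x\<in>UNIV. \<Sum>y\<in>UNIV. h y * W x y) = 0" for h :: "'a \<Rightarrow> real"
    by (subst sum.swap) (use diag[of h] in \<open>simp add: sym\<close>)
  have cross: "(\<Sum>x\<in>UNIV. \<Sum>y\<in>UNIV. f y * g x * W x y) = (\<Sum>x\<in>UNIV. \<Sum>y\<in>UNIV. f x * g y * W x y)"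
    by (subst sum.swap) (simp add: sym)
  have "(\<Sum>x\<in>UNIV. \<Sum>y\<in>UNIV. (f x - f y) * (g x - g y) * W x y)
      = (\<Sum>x\<in>UNIV. \<Sum>y\<in>UNIV. (f x * g x) * W x y + (f y * g y) * W x y
          - f x * g y * W x y - f y * g x * W x y)"
    by (intro sum.cong refl) (simp add: algebra_simps)
  also have "\<dots> = - 2 * (\<Sum>x\<in>UNIV. \<Sum>y\<in>UNIV. f x * g y * W x y)"
    using diag[of "\<lambda>x. f x * g x"] diag'[of "\<lambda>x. f x * g x"]
    by (simp add: sum.distrib sum_subtractf cross)
  also have "(\<Sum>x\<in>UNIV. \<Sum>y\<in>UNIV. f x * g y * W x y) = - energy s f g"
    by (simp add: energy_def gen_def W_def sum_distrib_left sum_distrib_right algebra_simps)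
  finally show ?thesis
    by (simp add: W_def)
qed

lemma energy_nonneg:
  assumes "0 \<le> s"
  shows "0 \<le> energy s f f"
  unfolding energy_eq[OF assms]
proof (intro divide_nonneg_pos sum_nonneg)
  fix x y
  show "0 \<le> (f x - f y) * (f x - f y) * (pmf (mu s) x * L s x y)"
    using L_nonneg[OF assms, of x y] by (cases "x = y") auto
qed simp

lemma energy_shift:
  assumes "0 \<le> s"
  shows "energy s (\<lambda>x. f x - c) (\<lambda>x. f x - c) = energy s f f"
  unfolding energy_eq[OF assms] by simp

lemma energy_power:
  assumes s: "0 \<le> s" and k: "1 \<le> k"
  shows "real (2 * k - 1) * energy s (\<lambda>x. u x ^ k) (\<lambda>x. u x ^ k)
    \<le> (real k)\<^sup>2 * energy s (\<lambda>x. u x ^ (2 * k - 1)) u"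
  unfolding energy_eq[OF s] times_divide_eq_right sum_distrib_left
proof (intro divide_right_mono sum_mono)
  fix x y
  show "real (2 * k - 1) * ((u x ^ k - u y ^ k) * (u x ^ k - u y ^ k) * (pmf (mu s) x * L s x y))
    \<le> (real k)\<^sup>2 * ((u x ^ (2 * k - 1) - u y ^ (2 * k - 1)) * (u x - u y) * (pmf (mu s) x * L s x y))"
  \<comment> \<open>Diagonal weights may be negative, but their terms are 0.\<close>
  proof (cases "x = y")
    case False
    then have "0 \<le> pmf (mu s) x * L s x y"
      using L_nonneg[OF s] by simp
    from mult_right_mono[OF stroock_varopoulos[OF k, of "u x" "u y"] this] show ?thesis
      by (simp only: power2_eq_square mult.assoc mult.commute mult.left_commute)
  qed simp
qed simp

text \<open>Each quotient at the given \<open>g\<close> lies below its supremum, so the extended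
  real hypothesis yields a real inequality through \<open>ratio_bound\<close>, even when the energy
  of \<open>g\<close> is 0.\<close>

lemma constants_bound:
  assumes s: "0 \<le> s" and c: "0 < c1" "0 \<le> c2" "0 \<le> c3"
    and lam: "ereal c1 * const_A mu L s + ereal c2 * const_B mu L s + ereal c3 * const_C mu L s
      \<le> ereal (lam s)"
    and g: "mean (mu s) g = 0"
  shows "c1 * - mean (mu s) (\<lambda>x. neg_log_deriv mu s x * (g x)\<^sup>2)
      + c2 * (mean (mu s) (\<lambda>x. neg_log_deriv mu s x * g x))\<^sup>2
      + c3 * mean (mu s) (\<lambda>x. (g x)\<^sup>2) \<le> lam s * energy s g g"
proof (cases "g = (\<lambda>_. 0)")
  case True
  then show ?thesis by (simp add: energy_def)
next
  case False
  then have g: "g \<in> centered (mu s)"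
    using g by (simp add: centered_def expectation_finite)
  have upper: "h g \<le> Sup0 (h ` centered (mu s))" for h :: "('a \<Rightarrow> real) \<Rightarrow> ereal"
    using g by (auto simp: Sup0_def intro: Sup_upper)
  have A: "ereal (- mean (mu s) (\<lambda>x. neg_log_deriv mu s x * (g x)\<^sup>2)) / ereal (energy s g g)
      \<le> const_A mu L s"
    unfolding const_A_def by (rule order_trans[OF _ upper])
      (simp add: expectation_finite dirichlet_eq_energy sum_negf)
  have B: "ereal ((mean (mu s) (\<lambda>x. neg_log_deriv mu s x * g x))\<^sup>2) / ereal (energy s g g)
      \<le> const_B mu L s"
    unfolding const_B_def by (rule order_trans[OF _ upper])
      (simp add: expectation_finite dirichlet_eq_energy)
  have C: "ereal (mean (mu s) (\<lambda>x. (g x)\<^sup>2)) / ereal (energy s g g) \<le> const_C mu L s"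
    unfolding const_C_def by (rule order_trans[OF _ upper])
      (simp add: expectation_finite dirichlet_eq_energy)
  show ?thesis
  proof (rule ratio_bound[OF _ energy_nonneg[OF s] _ _ c])
    show "ereal c1 * (ereal (- mean (mu s) (\<lambda>x. neg_log_deriv mu s x * (g x)\<^sup>2)) / ereal (energy s g g))
        + ereal c2 * (ereal ((mean (mu s) (\<lambda>x. neg_log_deriv mu s x * g x))\<^sup>2) / ereal (energy s g g))
        + ereal c3 * (ereal (mean (mu s) (\<lambda>x. (g x)\<^sup>2)) / ereal (energy s g g)) \<le> ereal (lam s)"
      using c by (intro order_trans[OF _ lam] add_mono ereal_mult_left_mono A B C) auto
  qed (auto intro!: sum_nonneg)
qed

text \<open>\<open>neg_log_deriv\<close> is \<open>D\<close> minus its mean, hence centered. The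
  same difference appears in the quotient rule for
  \<open>exp (- Ham r x) * pmf (mu 0) x / Z r\<close>, because the derivative of \<open>Z\<close> is
  \<open>- mean (mu s) D * Z s\<close>.\<close>

lemma neg_log_deriv_properties:
  assumes s: "0 \<le> s"
  shows mean_neg_log_deriv: "mean (mu s) (neg_log_deriv mu s) = 0"
    and pmf_has_derivative: "((\<lambda>r. pmf (mu r) x) has_real_derivative
      - neg_log_deriv mu s x * pmf (mu s) x) (at s within {0..})"
proof -
  have "\<exists>d. ((\<lambda>r. Ham r x) has_real_derivative d) (at s within {0..})" for x
    using Ham_C1[of x] s by auto
  then obtain D where D: "\<And>x. ((\<lambda>r. Ham r x) has_real_derivative D x) (at s within {0..})"
    by metis
  note H = neg_log_deriv_eq[OF s D, unfolded expectation_finite]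
  show "mean (mu s) (neg_log_deriv mu s) = 0"
    unfolding H left_diff_distrib sum_subtractf by simp
  define Z where "Z r = (\<Sum>y\<in>UNIV. exp (- Ham r y) * pmf (mu 0) y)" for r
  have Z_pos: "0 < Z r" for r
    unfolding Z_def using mu_pos[of 0] by (intro sum_pos) auto
  have dZ: "(Z has_real_derivative (\<Sum>y\<in>UNIV. - D y * exp (- Ham s y) * pmf (mu 0) y)) (at s within {0..})"
    unfolding Z_def[abs_def]
    by (rule DERIV_cong, (rule derivative_intros D)+) (simp add: algebra_simps)
  have mu_Z: "pmf (mu r) y = exp (- Ham r y) * pmf (mu 0) y / Z r" if "r \<in> {0..}" for r y
    using mu_eq[of r y] that by (simp add: normalization_def Z_def)
  have dZ_eq: "(\<Sum>y\<in>UNIV. - D y * exp (- Ham s y) * pmf (mu 0) y) = - mean (mu s) D * Z s"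
    using Z_pos[of s] s by (simp add: mu_Z[of s] sum_divide_distrib[symmetric] sum_negf mult.assoc)
  have dE: "((\<lambda>r. exp (- Ham r x) * pmf (mu 0) x) has_real_derivative
      exp (- Ham s x) * - D x * pmf (mu 0) x) (at s within {0..})"
    by (rule DERIV_cmult_right, rule DERIV_chain2[OF DERIV_exp], rule DERIV_minus, rule D)
  have "((\<lambda>r. exp (- Ham r x) * pmf (mu 0) x / Z r) has_real_derivative
      ((exp (- Ham s x) * - D x * pmf (mu 0) x) * Z s
        - exp (- Ham s x) * pmf (mu 0) x * (- mean (mu s) D * Z s)) / (Z s * Z s)) (at s within {0..})"
    using Z_pos[of s] by (intro DERIV_divide dZ[unfolded dZ_eq] dE) simp
  moreover have "((exp (- Ham s x) * - D x * pmf (mu 0) x) * Z s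
        - exp (- Ham s x) * pmf (mu 0) x * (- mean (mu s) D * Z s)) / (Z s * Z s)
      = - neg_log_deriv mu s x * pmf (mu s) x"
  proof -
    have "((e * - d * p) * z - e * p * (- M * z)) / (z * z) = - (d - M) * (e * p / z)"
      if "z \<noteq> 0" for d e p z M :: real
      using that by (simp add: field_simps)
    from this[of "Z s"] Z_pos[of s] s show ?thesis
      by (simp only: H mu_Z[of s x] atLeast_iff)
  qed
  ultimately have "((\<lambda>r. exp (- Ham r x) * pmf (mu 0) x / Z r) has_real_derivative
      - neg_log_deriv mu s x * pmf (mu s) x) (at s within {0..})"
    by simp
  then show "((\<lambda>r. pmf (mu r) x) has_real_derivative
      - neg_log_deriv mu s x * pmf (mu s) x) (at s within {0..})"
  proof (rule has_field_derivative_transform_within[where d = 1])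
    fix r :: real assume "r \<in> {0..}"
    then show "exp (- Ham r x) * pmf (mu 0) x / Z r = pmf (mu r) x"
      by (rule mu_Z[symmetric])
  qed (use s in auto)
qed

end

section \<open>Moment inequalities for a single probability measure\<close>

lemma mean_variance: "mean m (\<lambda>x. (g x - mean m g)\<^sup>2) = mean m (\<lambda>x. (g x)\<^sup>2) - (mean m g)\<^sup>2"
proof -
  define M where "M = mean m g"
  have "mean m (\<lambda>x. (g x - M)\<^sup>2)
      = (\<Sum>x\<in>UNIV. (g x)\<^sup>2 * pmf m x - 2 * M * (g x * pmf m x) + M\<^sup>2 * pmf m x)"
    by (simp add: power2_diff algebra_simps)
  also have "\<dots> = mean m (\<lambda>x. (g x)\<^sup>2) - 2 * M * mean m g + M\<^sup>2 * (\<Sum>x\<in>UNIV. pmf m x)"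
    by (simp only: sum.distrib sum_subtractf sum_distrib_left)
  finally show ?thesis
    by (simp add: M_def power2_eq_square)
qed

text \<open>Hoelder's inequality against the constant 1. It serves at the final time, to pass from
  the second moment of \<open>f\<close> to its moment of order \<open>2 * k\<close>.\<close>

lemma mean_power_le:
  assumes "1 \<le> k"
  shows "(mean m (\<lambda>x. (g x)\<^sup>2)) ^ k \<le> mean m (\<lambda>x. g x ^ (2 * k))"
proof -
  define A where "A = mean m (\<lambda>x. g x ^ (2 * k))"
  have A: "0 \<le> A"
    unfolding A_def by (intro sum_nonneg mult_nonneg_nonneg) (auto simp: power_mult)
  have "mean m (\<lambda>x. (g x)\<^sup>2) = mean m (\<lambda>x. (g x ^ (2 * k)) powr (1 / real k) * 1 powr (1 - 1 / real k))"
  proof (intro sum.cong refl)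
    fix x
    have "(((g x)\<^sup>2) ^ k) powr (1 / real k) = (g x)\<^sup>2"
      using assms by (cases "g x = 0") (simp_all add: powr_powr flip: powr_realpow)
    then show "(g x)\<^sup>2 * pmf m x = (g x ^ (2 * k)) powr (1 / real k) * 1 powr (1 - 1 / real k) * pmf m x"
      by (simp add: power_mult)
  qed
  also have "\<dots> \<le> A powr (1 / real k) * mean m (\<lambda>_. 1) powr (1 - 1 / real k)"
    unfolding A_def using assms
    by (intro holder_sum) (auto simp: power_mult)
  finally have "mean m (\<lambda>x. (g x)\<^sup>2) \<le> A powr (1 / real k)"
    by simp
  then have "(mean m (\<lambda>x. (g x)\<^sup>2)) ^ k \<le> (A powr (1 / real k)) ^ k"
    by (intro power_mono sum_nonneg) auto
  also have "\<dots> = A"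
    using A assms by (cases "A = 0") (simp_all add: powr_powr flip: powr_realpow)
  finally show ?thesis
    by (simp add: A_def)
qed

text \<open>
  For \<open>k = 2\<close> the last exponent vanishes; the junk value \<open>0 powr 0 = 0\<close> is harmless since the
  left-hand side is then \<open>0\<close> as well.
\<close>

lemma mean_power_interpolation:
  assumes k: "2 \<le> k"
  shows "(mean m (\<lambda>x. g x ^ k))\<^sup>2
    \<le> ((mean m (\<lambda>x. (g x)\<^sup>2)) ^ k) powr (1 / (real k - 1))
      * (mean m (\<lambda>x. g x ^ (2 * k))) powr (1 - 1 / (real k - 1))"
proof -
  define A B where "A = mean m (\<lambda>x. (g x)\<^sup>2)" and "B = mean m (\<lambda>x. g x ^ (2 * k))"
  \<comment> \<open>Chosen so that the exponents of \<open>\<bar>g x\<bar>\<close> match: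
    \<open>2 * l + 2 * k * (1 - l) = k\<close>.\<close>
  define l where "l = real k / (2 * (real k - 1))"
  have l: "0 \<le> l" "0 \<le> 1 - l" "2 * l = real k * (1 / (real k - 1))" "2 * (1 - l) = 1 - 1 / (real k - 1)"
    using k by (auto simp: l_def field_simps)
  have "l * (2 * (real k - 1)) = real k"
    using k by (simp add: l_def)
  then have exponent: "2 * l + 2 * real k * (1 - l) = real k"
    by (simp add: algebra_simps)
  have AB: "0 \<le> A" "0 \<le> B"
    unfolding A_def B_def by (auto intro!: sum_nonneg mult_nonneg_nonneg simp: power_mult)
  have "\<bar>mean m (\<lambda>x. g x ^ k)\<bar> \<le> mean m (\<lambda>x. \<bar>g x\<bar> ^ k)"
    by (rule order_trans[OF sum_abs]) (simp add: abs_mult power_abs)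
  also have "\<dots> = mean m (\<lambda>x. ((g x)\<^sup>2) powr l * (g x ^ (2 * k)) powr (1 - l))"
  proof (intro sum.cong refl)
    fix x
    show "\<bar>g x\<bar> ^ k * pmf m x = ((g x)\<^sup>2) powr l * (g x ^ (2 * k)) powr (1 - l) * pmf m x"
    proof (cases "g x = 0")
      case True
      then show ?thesis using k by simp
    next
      case False
      then have pos: "0 < \<bar>g x\<bar>" by simp
      have sq: "(g x)\<^sup>2 = \<bar>g x\<bar> powr 2" "g x ^ (2 * k) = \<bar>g x\<bar> powr (2 * real k)"
        using pos powr_realpow[OF pos, of "2 * k"] by (simp_all add: power_mult)
      show ?thesis
        unfolding sq powr_powr powr_add[symmetric] exponent using pos by (simp add: powr_realpow)
    qed
  qed
  also have "\<dots> \<le> A powr l * B powr (1 - l)"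
    unfolding A_def B_def using l by (intro holder_sum) (auto simp: power_mult)
  finally have "(mean m (\<lambda>x. g x ^ k))\<^sup>2 \<le> (A powr l * B powr (1 - l))\<^sup>2"
    by (simp add: abs_le_square_iff[symmetric])
  also have "\<dots> = (A powr l)\<^sup>2 * (B powr (1 - l))\<^sup>2"
    by (rule power_mult_distrib)
  also have "(A powr l)\<^sup>2 = A powr (real k * (1 / (real k - 1)))"
    using powr_powr[of A l 2] l(3) by (simp add: mult.commute)
  also have "\<dots> = (A ^ k) powr (1 / (real k - 1))"
    using powr_powr[of A "real k" "1 / (real k - 1)"] AB k by (simp add: powr_realpow')
  also have "(B powr (1 - l))\<^sup>2 = B powr (1 - 1 / (real k - 1))"
  proof -
    have "(B powr (1 - l))\<^sup>2 = (B powr (1 - l)) powr 2"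
      by simp
    also have "\<dots> = B powr (2 * (1 - l))"
      by (simp only: powr_powr mult.commute)
    finally show ?thesis
      by (simp only: l(4))
  qed
  finally show ?thesis
    by (simp add: A_def B_def)
qed

lemma Lp_norm_eq:
  assumes "1 \<le> k"
  shows "Lp_norm (real (2 * k)) m g = (mean m (\<lambda>x. g x ^ (2 * k))) powr (1 / real (2 * k))"
proof -
  have "\<bar>g x\<bar> powr real (2 * k) = g x ^ (2 * k)" for x
    using assms powr_realpow'[of "\<bar>g x\<bar>" "2 * k"] by (simp add: power_mult)
  then show ?thesis
    by (simp add: Lp_norm_def)
qed

section \<open>The assumption on \<open>lam\<close> as a real inequality\<close>

context evolving_measures
begin

text \<open>The form in which the hypothesis on \<open>lam\<close> enters the estimates, free of
  suprema and infinite values; \<open>c1\<close>, \<open>c2\<close>, \<open>c3\<close> are the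
  coefficients of A, B, C.\<close>

definition energy_bound :: "real \<Rightarrow> real \<Rightarrow> real \<Rightarrow> real \<Rightarrow> bool" where
  "energy_bound c1 c2 c3 s \<longleftrightarrow> (\<forall>g. mean (mu s) g = 0 \<longrightarrow>
      c1 * - mean (mu s) (\<lambda>x. neg_log_deriv mu s x * (g x)\<^sup>2)
      + c2 * (mean (mu s) (\<lambda>x. neg_log_deriv mu s x * g x))\<^sup>2
      + c3 * mean (mu s) (\<lambda>x. (g x)\<^sup>2) \<le> lam s * energy s g g)"

lemma energy_boundI:
  assumes "0 \<le> s" "0 < c1" "0 \<le> c2" "0 \<le> c3"
    and "ereal c1 * const_A mu L s + ereal c2 * const_B mu L s + ereal c3 * const_C mu L s
      \<le> ereal (lam s)"
  shows "energy_bound c1 c2 c3 s"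
  unfolding energy_bound_def using constants_bound[OF assms] by blast

text \<open>
  The quadratic form on the left is affine in \<open>p\<close> and nonpositive at \<open>p = 0\<close>.  So it either
  increases in \<open>p\<close> or is bounded by \<open>0\<close>; this covers negative \<open>A\<close>.
\<close>

lemma energy_bound_2:
  assumes s: "0 \<le> s" and p: "2 \<le> p" and "0 \<le> \<beta>"
    and bound: "energy_bound (p / 4) (\<beta> * ((p - 1) / 4)) (\<alpha> * (p / 2)) s"
  shows "energy_bound (1 / 2) 0 \<alpha> s"
  unfolding energy_bound_def
proof (intro allI impI)
  fix g assume g: "mean (mu s) g = 0"
  define a x c E where "a = - mean (mu s) (\<lambda>x. neg_log_deriv mu s x * (g x)\<^sup>2)"
    and "x = (mean (mu s) (\<lambda>x. neg_log_deriv mu s x * g x))\<^sup>2"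
    and "c = mean (mu s) (\<lambda>x. (g x)\<^sup>2)" and "E = lam s * energy s g g"
  have "0 \<le> \<beta> * x" "0 \<le> E"
    using \<open>0 \<le> \<beta>\<close> energy_nonneg[OF s, of g] lam_pos[OF s] by (simp_all add: x_def E_def)
  have "p / 4 * a + \<beta> * ((p - 1) / 4) * x + \<alpha> * (p / 2) * c \<le> E"
    using bound g unfolding energy_bound_def a_def x_def c_def E_def by blast
  \<comment> \<open>As an affine function of \<open>p\<close>, the quadratic form has slope
    \<open>M / 4\<close> and value \<open>- \<beta> * x / 4\<close> at \<open>p = 0\<close>.\<close>
  moreover define M where "M = a + \<beta> * x + 2 * \<alpha> * c"
  ultimately have upper: "p / 4 * M \<le> E + \<beta> * x / 4"
    by (simp add: field_simps)
  have "M \<le> 2 * E + \<beta> * x"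
  proof (cases "M \<le> 0")
    case True
    with \<open>0 \<le> \<beta> * x\<close> \<open>0 \<le> E\<close> show ?thesis by linarith
  next
    case False
    then have "1 / 2 * M \<le> p / 4 * M"
      using p by (intro mult_right_mono) auto
    then have "1 / 2 * M \<le> E + \<beta> * x / 4"
      using upper by (rule order_trans)
    with \<open>0 \<le> \<beta> * x\<close> show ?thesis by linarith
  qed
  then have "1 / 2 * a + 0 * x + \<alpha> * c \<le> E"
    by (simp add: M_def)
  then show "1 / 2 * - mean (mu s) (\<lambda>x. neg_log_deriv mu s x * (g x)\<^sup>2)
      + 0 * (mean (mu s) (\<lambda>x. neg_log_deriv mu s x * g x))\<^sup>2
      + \<alpha> * mean (mu s) (\<lambda>x. (g x)\<^sup>2) \<le> lam s * energy s g g"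
    by (simp only: a_def x_def c_def E_def)
qed

end

section \<open>Derivatives of moments along the backward equation; decay for p = 2\<close>

locale propagator = evolving_measures +
  fixes t :: real and f :: "'a \<Rightarrow> real" and u :: "real \<Rightarrow> 'a \<Rightarrow> real"
  assumes solution: "backward_solution mu L lam t f u"
    and mean_f: "mean (mu t) f = 0" and t: "0 \<le> t"
begin

lemma u_t [simp]: "u t = f"
  using solution by (simp add: backward_solution_def)

text \<open>The equation for \<open>u\<close> contributes \<open>m\<close> times the integral of
  \<open>neg_log_deriv\<close> against \<open>u ^ m\<close>, and the moving measure removes one
  copy, leaving the factor \<open>m - 1\<close>.\<close>

lemma moment_has_derivative:
  assumes s: "s \<in> {0..t}" and m: "1 \<le> m"
  shows "((\<lambda>s. mean (mu s) (\<lambda>x. u s x ^ m)) has_real_derivative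
      real m * (lam s * energy s (\<lambda>x. u s x ^ (m - 1)) (u s))
      + (real m - 1) * mean (mu s) (\<lambda>x. neg_log_deriv mu s x * u s x ^ m)) (at s within {0..t})"
proof -
  let ?H = "neg_log_deriv mu s" and ?G = "gen (L s) (u s)"
  have du: "((\<lambda>r. u r x) has_real_derivative - (lam s * ?G x - ?H x * u s x)) (at s within {0..t})" for x
    using solution s by (auto simp: backward_solution_def)
  have dmu: "((\<lambda>r. pmf (mu r) x) has_real_derivative - ?H x * pmf (mu s) x) (at s within {0..t})" for x
    using s by (intro DERIV_subset[OF pmf_has_derivative]) auto
  have "((\<lambda>s. mean (mu s) (\<lambda>x. u s x ^ m)) has_real_derivative
      (\<Sum>x\<in>UNIV. (real m * (- (lam s * ?G x - ?H x * u s x) * u s x ^ (m - Suc 0))) * pmf (mu s) x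
        + (- ?H x * pmf (mu s) x) * u s x ^ m)) (at s within {0..t})"
    by (intro DERIV_sum DERIV_mult DERIV_power du dmu)
  also have "(\<lambda>x. (real m * (- (lam s * ?G x - ?H x * u s x) * u s x ^ (m - Suc 0))) * pmf (mu s) x
        + (- ?H x * pmf (mu s) x) * u s x ^ m)
      = (\<lambda>x. real m * (lam s * - (u s x ^ (m - 1) * ?G x * pmf (mu s) x))
        + (real m - 1) * (?H x * u s x ^ m * pmf (mu s) x))"
  proof
    fix x
    have "u s x ^ m = u s x * u s x ^ (m - 1)"
      using m by (simp add: power_eq_if)
    then show "(real m * (- (lam s * ?G x - ?H x * u s x) * u s x ^ (m - Suc 0))) * pmf (mu s) x
        + (- ?H x * pmf (mu s) x) * u s x ^ m
      = real m * (lam s * - (u s x ^ (m - 1) * ?G x * pmf (mu s) x))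
        + (real m - 1) * (?H x * u s x ^ m * pmf (mu s) x)"
      by (simp add: algebra_simps)
  qed
  finally show ?thesis
    by (simp only: sum.distrib sum_distrib_left[symmetric] sum_negf energy_def)
qed

text \<open>For \<open>m = 1\<close> the factor \<open>m - 1\<close> is 0 and the energy pairs
  \<open>u\<close> with a constant, so the mean is conserved.\<close>

lemma mean_u:
  assumes s: "s \<in> {0..t}"
  shows "mean (mu s) (u s) = 0"
proof -
  have "((\<lambda>s. mean (mu s) (u s)) has_real_derivative 0) (at r within {0..t})" if "r \<in> {0..t}" for r
    using moment_has_derivative[OF that, of 1] that by (simp add: energy_eq)
  then have "mean (mu s) (u s) \<le> mean (mu t) (u t)" "- mean (mu s) (u s) \<le> - mean (mu t) (u t)"
    using gronwall_backward[of t "\<lambda>s. mean (mu s) (u s)" "\<lambda>_. 0" 0 s]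
      gronwall_backward[of t "\<lambda>s. - mean (mu s) (u s)" "\<lambda>_. 0" 0 s] s
      DERIV_minus[of "\<lambda>s. mean (mu s) (u s)" 0]
    by force+
  then show ?thesis
    using mean_f by simp
qed

text \<open>The energy of \<open>u ^ (2 * k - 1)\<close> against \<open>u\<close> is traded for that
  of \<open>u ^ k\<close>, to which \<open>energy_bound\<close> can be applied after centering. Only
  this lower bound on the derivative matters later.\<close>

lemma even_moment_has_derivative:
  assumes s: "s \<in> {0..t}" and k: "1 \<le> k"
  obtains F' where "((\<lambda>s. mean (mu s) (\<lambda>x. u s x ^ (2 * k))) has_real_derivative F') (at s within {0..t})"
    and "real (2 * k - 1) * (2 / real k * (lam s * energy s (\<lambda>x. u s x ^ k) (\<lambda>x. u s x ^ k))
      + mean (mu s) (\<lambda>x. neg_log_deriv mu s x * (u s x ^ k)\<^sup>2)) \<le> F'"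
proof (rule that)
  let ?e = "energy s (\<lambda>x. u s x ^ k) (\<lambda>x. u s x ^ k)"
  show "((\<lambda>s. mean (mu s) (\<lambda>x. u s x ^ (2 * k))) has_real_derivative
      real (2 * k) * (lam s * energy s (\<lambda>x. u s x ^ (2 * k - 1)) (u s))
      + (real (2 * k) - 1) * mean (mu s) (\<lambda>x. neg_log_deriv mu s x * u s x ^ (2 * k))) (at s within {0..t})"
    using k by (intro moment_has_derivative s) auto
  have "2 / real k * (lam s * (real (2 * k - 1) * ?e))
      \<le> 2 / real k * (lam s * ((real k)\<^sup>2 * energy s (\<lambda>x. u s x ^ (2 * k - 1)) (u s)))"
    using s lam_pos[of s] by (intro mult_left_mono energy_power k) auto
  also have "\<dots> = real (2 * k) * (lam s * energy s (\<lambda>x. u s x ^ (2 * k - 1)) (u s))"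
    using k by (simp add: power2_eq_square)
  finally have le: "2 / real k * (lam s * (real (2 * k - 1) * ?e))
      \<le> real (2 * k) * (lam s * energy s (\<lambda>x. u s x ^ (2 * k - 1)) (u s))" .
  show "real (2 * k - 1) * (2 / real k * (lam s * ?e)
      + mean (mu s) (\<lambda>x. neg_log_deriv mu s x * (u s x ^ k)\<^sup>2))
    \<le> real (2 * k) * (lam s * energy s (\<lambda>x. u s x ^ (2 * k - 1)) (u s))
      + (real (2 * k) - 1) * mean (mu s) (\<lambda>x. neg_log_deriv mu s x * u s x ^ (2 * k))"
  proof -
    have "A * (B * (l * e) + h) \<le> R + A * h" if "B * (l * (A * e)) \<le> R" for A B l e h R :: real
      using that by (simp add: algebra_simps)
    moreover have "(u s x ^ k)\<^sup>2 = u s x ^ (2 * k)" for x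
      by (simp add: power_mult[symmetric] mult.commute)
    moreover have "real (2 * k) - 1 = real (2 * k - 1)"
      using k by simp
    ultimately show ?thesis
      using le by (simp only:)
  qed
qed

text \<open>Since \<open>u\<close> has mean 0, \<open>energy_bound\<close> applies to
  \<open>u\<close> itself; doubled, it absorbs the term with \<open>neg_log_deriv\<close> and leaves
  \<open>2 * \<alpha> * F\<close>.\<close>

lemma second_moment_decay:
  assumes bound: "\<And>s. s \<in> {0..t} \<Longrightarrow> energy_bound (1 / 2) 0 \<alpha> s" and s: "s \<in> {0..t}"
  shows "mean (mu s) (\<lambda>x. (u s x)\<^sup>2) \<le> exp (- (2 * \<alpha>) * (t - s)) * mean (mu t) (\<lambda>x. (f x)\<^sup>2)"
proof -
  define F where "F r = mean (mu r) (\<lambda>x. (u r x)\<^sup>2)" for r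
  have "\<exists>F'. (F has_real_derivative F') (at r within {0..t}) \<and> 2 * \<alpha> * F r \<le> F'" if r: "r \<in> {0..t}" for r
  proof -
    obtain F' where F': "(F has_real_derivative F') (at r within {0..t})"
      "2 * (lam r * energy r (u r) (u r)) + mean (mu r) (\<lambda>x. neg_log_deriv mu r x * (u r x)\<^sup>2) \<le> F'"
      using even_moment_has_derivative[OF r, of 1] by (auto simp: F_def[abs_def])
    have "1 / 2 * - mean (mu r) (\<lambda>x. neg_log_deriv mu r x * (u r x)\<^sup>2) + \<alpha> * F r
        \<le> lam r * energy r (u r) (u r)"
      using bound[OF r] mean_u[OF r] by (auto simp: energy_bound_def F_def)
    with F' show ?thesis
      by (intro exI[of _ F']) auto
  qed
  then obtain F' where "\<And>r. r \<in> {0..t} \<Longrightarrow> (F has_real_derivative F' r) (at r within {0..t})"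
    "\<And>r. r \<in> {0..t} \<Longrightarrow> 2 * \<alpha> * F r \<le> F' r"
    by metis
  then have "F s \<le> exp (- (2 * \<alpha>) * (t - s)) * F t"
    using s by (rule gronwall_backward)
  then show ?thesis by (simp add: F_def)
qed

end

section \<open>Decay of the higher even moments\<close>

context propagator
begin

lemma even_moment_decay:
  assumes k: "2 \<le> k" and \<alpha>: "0 < \<alpha>" and \<beta>: "0 < \<beta>"
    and bound: "\<And>s. s \<in> {0..t} \<Longrightarrow> energy_bound (real (2 * k) / 4) (\<beta> * ((real (2 * k) - 1) / 4))
      (\<alpha> * (real (2 * k) / 2)) s"
    and s: "s \<in> {0..t}"
  shows "mean (mu s) (\<lambda>x. u s x ^ (2 * k))
    \<le> (2 + 1 / (\<alpha> * \<beta>)) ^ k * (exp (- (2 * real k * \<alpha>) * (t - s)) * mean (mu t) (\<lambda>x. f x ^ (2 * k)))"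
proof -
  define F where "F r = mean (mu r) (\<lambda>x. u r x ^ (2 * k))" for r
  \<comment> \<open>The barrier is \<open>M * G\<close>, where \<open>G\<close> grows at rate
    \<open>2 * k * \<alpha>\<close> and agrees with \<open>F\<close> at time
    \<open>t\<close>.\<close>
  define D M where "D = 2 + 1 / (\<alpha> * \<beta>)" and "M = D ^ k"
  define G where "G r = exp (- (2 * real k * \<alpha>) * (t - r)) * F t" for r
  \<comment> \<open>The weight of the second moment in
    \<open>mean_power_interpolation\<close>.\<close>
  define e where "e = 1 / (real k - 1)"
  have e: "0 \<le> e" "0 \<le> 1 - e" "(real k - 1) * e = 1"
    using k by (auto simp: e_def)
  have D: "1 \<le> D"
    using \<alpha> \<beta> by (simp add: D_def)
  have M: "1 \<le> M"
    using D by (simp add: M_def one_le_power)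
  have F_nonneg: "0 \<le> F r" for r
    unfolding F_def by (intro sum_nonneg mult_nonneg_nonneg) (auto simp: power_mult)
  have G_nonneg: "0 \<le> G r" for r
    unfolding G_def using F_nonneg by simp
  have M_e: "M powr e = D powr (real k / (real k - 1))"
    using D powr_powr[of D "real k" e] by (simp add: M_def e_def powr_realpow)
  \<comment> \<open>The left side is the coefficient of the squared mean of \<open>u ^ k\<close> in
    the differential inequality for \<open>F\<close>.\<close>
  have K_le: "2 * \<alpha> * real (2 * k - 1) + 2 * real k / \<beta> \<le> 2 * \<alpha> * (real k - 1) * M powr e"
  proof -
    have "2 * \<alpha> * (real (2 * k - 1) + real k * (1 / (\<alpha> * \<beta>)))
        \<le> 2 * \<alpha> * ((real k - 1) * (2 + 1 / (\<alpha> * \<beta>)) powr (real k / (real k - 1)))"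
      using \<alpha> \<beta> k by (intro mult_left_mono exponent_constant_bound) auto
    then show ?thesis
      using \<alpha> by (simp add: M_e D_def[symmetric] distrib_left mult.assoc)
  qed
  \<comment> \<open>Interpolation and the known decay of the second moment bound the squared mean by
    \<open>G powr e * F powr (1 - e)\<close>. The factor \<open>M powr e\<close> is absorbed into
    \<open>G\<close>, and Young's inequality splits the product; multiplied by \<open>k - 1\<close>,
    the weights \<open>e\<close> and \<open>1 - e\<close> become 1 and \<open>k - 2\<close>.\<close>
  have middle: "(2 * \<alpha> * real (2 * k - 1) + 2 * real k / \<beta>) * (mean (mu r) (\<lambda>x. u r x ^ k))\<^sup>2
      \<le> 2 * \<alpha> * (M * G r) + 2 * \<alpha> * (real k - 2) * F r" if r: "r \<in> {0..t}" for r
  proof -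
    have "(mean (mu r) (\<lambda>x. (u r x)\<^sup>2)) ^ k
        \<le> (exp (- (2 * \<alpha>) * (t - r)) * mean (mu t) (\<lambda>x. (f x)\<^sup>2)) ^ k"
    proof (intro power_mono second_moment_decay r)
      fix r assume "r \<in> {0..t}"
      then show "energy_bound (1 / 2) 0 \<alpha> r"
        using \<beta> k by (intro energy_bound_2[OF _ _ _ bound]) auto
    qed (auto intro!: sum_nonneg)
    also have "\<dots> = exp (- (2 * real k * \<alpha>) * (t - r)) * mean (mu t) (\<lambda>x. (f x)\<^sup>2) ^ k"
      by (simp add: power_mult_distrib exp_of_nat_mult[symmetric] algebra_simps)
    also have "\<dots> \<le> G r"
      unfolding G_def F_def using k mean_power_le[where k = k and m = "mu t" and g = f] by (intro mult_left_mono) auto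
    finally have "((mean (mu r) (\<lambda>x. (u r x)\<^sup>2)) ^ k) powr e * F r powr (1 - e)
        \<le> G r powr e * F r powr (1 - e)"
      using e by (intro mult_right_mono powr_mono2 zero_le_power sum_nonneg) auto
    then have "(mean (mu r) (\<lambda>x. u r x ^ k))\<^sup>2 \<le> G r powr e * F r powr (1 - e)"
      using mean_power_interpolation[OF k, where m = "mu r" and g = "u r"] by (simp add: F_def e_def)
    then have "(2 * \<alpha> * real (2 * k - 1) + 2 * real k / \<beta>) * (mean (mu r) (\<lambda>x. u r x ^ k))\<^sup>2
        \<le> (2 * \<alpha> * (real k - 1) * M powr e) * (G r powr e * F r powr (1 - e))"
      using K_le k \<alpha> by (intro mult_mono) auto
    also have "\<dots> = (2 * \<alpha> * (real k - 1)) * ((M * G r) powr e * F r powr (1 - e))"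
      using M G_nonneg by (simp add: powr_mult)
    also have "\<dots> \<le> (2 * \<alpha> * (real k - 1)) * (e * (M * G r) + (1 - e) * F r)"
      using k \<alpha> M F_nonneg G_nonneg e by (intro mult_left_mono young_powr) auto
    also have "\<dots> = 2 * \<alpha> * ((real k - 1) * e) * (M * G r) + 2 * \<alpha> * (real k - 1 - (real k - 1) * e) * F r"
      by (simp only: algebra_simps)
    finally show ?thesis
      unfolding e(3) by simp
  qed
  define Y where "Y r = F r - M * G r" for r
  \<comment> \<open>For \<open>F\<close> the rate is \<open>2 * \<alpha> * (2 * k - 1)\<close> minus
    the \<open>2 * \<alpha> * (k - 2)\<close> lost in \<open>middle\<close>; for
    \<open>M * G\<close> it is \<open>2 * \<alpha>\<close> plus the growth rate
    \<open>2 * k * \<alpha>\<close>. Both equal \<open>2 * \<alpha> * (k + 1)\<close>.\<close>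
  have "\<exists>Y'. (Y has_real_derivative Y') (at r within {0..t}) \<and> 2 * \<alpha> * (real k + 1) * Y r \<le> Y'"
    if r: "r \<in> {0..t}" for r
  proof -
    let ?H = "neg_log_deriv mu r"
    let ?g = "\<lambda>x. u r x ^ k"
    let ?E = "lam r * energy r ?g ?g"
    define m X S where "m = mean (mu r) ?g" and "X = mean (mu r) (\<lambda>x. ?H x * ?g x)"
      and "S = mean (mu r) (\<lambda>x. ?H x * (?g x)\<^sup>2)"
    obtain F' where F': "(F has_real_derivative F') (at r within {0..t})"
      "real (2 * k - 1) * (2 / real k * ?E + S) \<le> F'"
      using even_moment_has_derivative[OF r, of k] k unfolding F_def[abs_def] S_def by auto
    have H0: "mean (mu r) ?H = 0"
      using r by (intro mean_neg_log_deriv) auto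
    \<comment> \<open>Centering \<open>u ^ k\<close> makes \<open>energy_bound\<close> applicable;
      as \<open>?H\<close> has mean 0, its only cost in the terms with \<open>?H\<close> is
      \<open>2 * m * X\<close>.\<close>
    have shift: "mean (mu r) (\<lambda>x. ?g x - m) = 0"
      "mean (mu r) (\<lambda>x. ?H x * (?g x - m)) = X"
      "mean (mu r) (\<lambda>x. ?H x * (?g x - m)\<^sup>2) = S - 2 * m * X"
      "mean (mu r) (\<lambda>x. (?g x - m)\<^sup>2) = F r - m\<^sup>2"
    proof -
      show "mean (mu r) (\<lambda>x. ?g x - m) = 0"
        by (simp add: left_diff_distrib sum_subtractf m_def)
      have "mean (mu r) (\<lambda>x. ?H x * (?g x - m)) = X - m * mean (mu r) ?H"
        unfolding X_def sum_distrib_left sum_subtractf[symmetric]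
        by (intro sum.cong refl) (simp add: algebra_simps)
      then show "mean (mu r) (\<lambda>x. ?H x * (?g x - m)) = X"
        unfolding H0 by simp
      have "mean (mu r) (\<lambda>x. ?H x * (?g x - m)\<^sup>2) = S - 2 * m * X + m\<^sup>2 * mean (mu r) ?H"
        unfolding X_def S_def sum_distrib_left sum_subtractf[symmetric] sum.distrib[symmetric]
        by (intro sum.cong refl) (simp add: power2_diff algebra_simps)
      then show "mean (mu r) (\<lambda>x. ?H x * (?g x - m)\<^sup>2) = S - 2 * m * X"
        unfolding H0 by simp
      show "mean (mu r) (\<lambda>x. (?g x - m)\<^sup>2) = F r - m\<^sup>2"
        unfolding m_def mean_variance F_def by (simp add: power_mult[symmetric] mult.commute)
    qed
    have "real (2 * k) / 4 * - (S - 2 * m * X) + \<beta> * ((real (2 * k) - 1) / 4) * X\<^sup>2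
        + \<alpha> * (real (2 * k) / 2) * (F r - m\<^sup>2) \<le> ?E"
      using bound[OF r, unfolded energy_bound_def, rule_format, OF shift(1)] r
      unfolding shift by (simp only: energy_shift atLeastAtMost_iff)
    then have "2 / real k * (real (2 * k) / 4 * - (S - 2 * m * X) + \<beta> * ((real (2 * k) - 1) / 4) * X\<^sup>2
        + \<alpha> * (real (2 * k) / 2) * (F r - m\<^sup>2)) \<le> 2 / real k * ?E"
      by (intro mult_left_mono) auto
    moreover define b where "b = \<beta> * (real (2 * k) - 1) / (2 * real k)"
    moreover have "2 / real k * (real (2 * k) / 4 * - y + \<beta> * ((real (2 * k) - 1) / 4) * z
        + \<alpha> * (real (2 * k) / 2) * v) = - y + b * z + 2 * \<alpha> * v" for y z v
      using k by (simp add: b_def field_simps)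
    ultimately have "- (S - 2 * m * X) + b * X\<^sup>2 + 2 * \<alpha> * (F r - m\<^sup>2) \<le> 2 / real k * ?E"
      by (simp only:)
    then have lower: "2 * m * X + b * X\<^sup>2 + 2 * \<alpha> * (F r - m\<^sup>2) \<le> 2 / real k * ?E + S"
      by linarith
    have b: "0 < b"
      using k \<beta> by (simp add: b_def)
    \<comment> \<open>Completing the square removes \<open>X\<close>, about which nothing is known,
      at the price \<open>m\<^sup>2 / b\<close>.\<close>
    have "0 \<le> b * (X + m / b)\<^sup>2"
      using b by simp
    also have "\<dots> = 2 * m * X + b * X\<^sup>2 + m\<^sup>2 / b"
      using b by (simp add: power2_eq_square field_simps)
    finally have "2 * \<alpha> * (F r - m\<^sup>2) - m\<^sup>2 / b \<le> 2 / real k * ?E + S"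
      using lower by linarith
    then have "real (2 * k - 1) * (2 * \<alpha> * (F r - m\<^sup>2) - m\<^sup>2 / b) \<le> F'"
      using F'(2) by (meson mult_left_mono of_nat_0_le_iff order_trans)
    moreover have "real (2 * k - 1) * (m\<^sup>2 / b) = 2 * real k / \<beta> * m\<^sup>2"
      using k \<beta> by (simp add: b_def field_simps)
    ultimately have "2 * \<alpha> * real (2 * k - 1) * F r
        - (2 * \<alpha> * real (2 * k - 1) + 2 * real k / \<beta>) * m\<^sup>2 \<le> F'"
      by (simp only: algebra_simps)
    with middle[OF r] have "2 * \<alpha> * real (2 * k - 1) * F r
        - (2 * \<alpha> * (M * G r) + 2 * \<alpha> * (real k - 2) * F r) \<le> F'"
      unfolding m_def by linarith
    moreover have "real (2 * k - 1) = 2 * real k - 1"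
      using k by simp
    ultimately have F'_ge: "2 * \<alpha> * (real k + 1) * F r - 2 * \<alpha> * (M * G r) \<le> F'"
      by (simp add: algebra_simps)
    have "(G has_real_derivative 2 * real k * \<alpha> * G r) (at r within {0..t})"
      unfolding G_def[abs_def] by (auto intro!: derivative_eq_intros)
    then have "(Y has_real_derivative F' - M * (2 * real k * \<alpha> * G r)) (at r within {0..t})"
      unfolding Y_def[abs_def] by (intro DERIV_diff DERIV_cmult F'(1))
    moreover have "2 * \<alpha> * (real k + 1) * Y r \<le> F' - M * (2 * real k * \<alpha> * G r)"
      using F'_ge by (simp add: Y_def algebra_simps)
    ultimately show ?thesis
      by blast
  qed
  then obtain Y' where "\<And>r. r \<in> {0..t} \<Longrightarrow> (Y has_real_derivative Y' r) (at r within {0..t})"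
    "\<And>r. r \<in> {0..t} \<Longrightarrow> 2 * \<alpha> * (real k + 1) * Y r \<le> Y' r"
    by metis
  then have "Y s \<le> exp (- (2 * \<alpha> * (real k + 1)) * (t - s)) * Y t"
    using s by (rule gronwall_backward)
  \<comment> \<open>At the final time \<open>Y t = (1 - M) * F t\<close>, and
    \<open>M \<ge> 1\<close>.\<close>
  also have "\<dots> \<le> 0"
    using mult_right_mono[OF M F_nonneg[of t]] by (intro mult_nonneg_nonpos) (auto simp: Y_def G_def)
  finally show ?thesis
    by (simp add: Y_def F_def G_def M_def D_def)
qed

section \<open>From moments to norms, and the degenerate cases\<close>

text \<open>Taking roots of order \<open>2 * k\<close> turns \<open>C ^ k\<close> into
  \<open>sqrt C\<close> and the rate \<open>2 * k * \<alpha>\<close> into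
  \<open>\<alpha>\<close>.\<close>

lemma Lp_norm_decay:
  assumes k: "1 \<le> k" and C: "0 \<le> C"
    and moment: "mean (mu s) (\<lambda>x. u s x ^ (2 * k))
      \<le> C ^ k * (exp (- (2 * real k * \<alpha>) * (t - s)) * mean (mu t) (\<lambda>x. f x ^ (2 * k)))"
  shows "Lp_norm (real (2 * k)) (mu s) (u s)
    \<le> exp (- \<alpha> * (t - s)) * sqrt C * Lp_norm (real (2 * k)) (mu t) f"
proof -
  define e where "e = 1 / real (2 * k)"
  have nonneg: "0 \<le> mean m (\<lambda>x. g x ^ (2 * k))" for m :: "'a pmf" and g
    by (intro sum_nonneg mult_nonneg_nonneg) (auto simp: power_mult)
  have "Lp_norm (real (2 * k)) (mu s) (u s)
      \<le> (C ^ k * (exp (- (2 * real k * \<alpha>) * (t - s)) * mean (mu t) (\<lambda>x. f x ^ (2 * k)))) powr e"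
    unfolding Lp_norm_eq[OF k] e_def using moment nonneg by (intro powr_mono2) auto
  also have "\<dots> = (C ^ k) powr e * (exp (- (2 * real k * \<alpha>) * (t - s)) powr e * Lp_norm (real (2 * k)) (mu t) f)"
    unfolding Lp_norm_eq[OF k] e_def[symmetric] using C nonneg by (simp add: powr_mult)
  also have "(C ^ k) powr e = sqrt C"
    using C k powr_powr[of C "real k" e] by (simp add: e_def powr_realpow' powr_half_sqrt)
  also have "exp (- (2 * real k * \<alpha>) * (t - s)) powr e = exp (- \<alpha> * (t - s))"
    using k by (simp add: powr_def e_def)
  finally show ?thesis
    by (simp add: mult_ac)
qed

lemma L2_norm_decay:
  assumes "\<And>s. s \<in> {0..t} \<Longrightarrow> energy_bound (1 / 2) 0 \<alpha> s" and "s \<in> {0..t}"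
  shows "Lp_norm 2 (mu s) (u s) \<le> exp (- \<alpha> * (t - s)) * Lp_norm 2 (mu t) f"
  using Lp_norm_decay[of 1 1 s \<alpha>] second_moment_decay[OF assms] by simp

text \<open>Needed when the constant in (ii) is infinite: the right side is then 0 if
  \<open>f\<close> has norm 0, by \<open>0 * \<infinity> = 0\<close>. In that case \<open>f\<close>
  vanishes, and the decay of the second moment forces \<open>u s\<close> to vanish too.\<close>

lemma propagator_0:
  assumes "\<And>s. s \<in> {0..t} \<Longrightarrow> energy_bound (1 / 2) 0 \<alpha> s" and s: "s \<in> {0..t}"
    and f: "Lp_norm p (mu t) f = 0" and p: "0 < p"
  shows "Lp_norm p (mu s) (u s) = 0"
proof -
  have "(\<Sum>x\<in>UNIV. \<bar>f x\<bar> powr p * pmf (mu t) x) = 0"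
    using f by (simp add: Lp_norm_def)
  then have zero: "\<bar>f x\<bar> powr p * pmf (mu t) x = 0" for x
    by (subst (asm) sum_nonneg_eq_0_iff) auto
  have "f x = 0" for x
    using zero[of x] mu_pos[OF t, of x] by auto
  then have "mean (mu s) (\<lambda>x. (u s x)\<^sup>2) \<le> 0"
    using second_moment_decay[OF assms(1) s] by simp
  then have "mean (mu s) (\<lambda>x. (u s x)\<^sup>2) = 0"
    by (intro antisym sum_nonneg) auto
  then have zero: "(u s x)\<^sup>2 * pmf (mu s) x = 0" for x
    by (subst (asm) sum_nonneg_eq_0_iff) auto
  have "u s x = 0" for x
    using zero[of x] mu_pos[of s x] s by auto
  then show ?thesis
    by (simp add: Lp_norm_def)
qed

end

lemma Lp_norm_nonneg: "0 \<le> Lp_norm p m f"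
  by (simp add: Lp_norm_def)

theorem theorem8:
  fixes mu :: "real \<Rightarrow> 'a::finite pmf"
    and Ham :: "real \<Rightarrow> 'a \<Rightarrow> real"
    and L :: "real \<Rightarrow> 'a \<Rightarrow> 'a \<Rightarrow> real"
    and lam :: "real \<Rightarrow> real"
    and t \<alpha> \<beta> :: real
    and f :: "'a \<Rightarrow> real"
    and q :: "real \<Rightarrow> 'a \<Rightarrow> real"
  assumes "evolving_measures mu Ham L lam"
    and "0 \<le> t" and "0 \<le> \<alpha>" and "0 \<le> \<beta>"
    and "measure_pmf.expectation (mu t) f = 0"
    and "backward_solution mu L lam t f q"
  shows
    "((\<forall>s\<in>{0..t}. ereal (lam s) \<ge> ereal (1 / 2) * const_A mu L s + ereal \<alpha> * const_C mu L s) \<longrightarrow>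
       (\<forall>s\<in>{0..t}. Lp_norm 2 (mu s) (q s) \<le> exp (- \<alpha> * (t - s)) * Lp_norm 2 (mu t) f)) \<and>
     (\<forall>(n::nat) (p::real). 1 \<le> n \<and> p = 2 ^ n \<and>
       (\<forall>s\<in>{0..t}. ereal (lam s) \<ge> ereal (p / 4) * const_A mu L s
           + ereal (\<beta> * ((p - 1) / 4)) * const_B mu L s + ereal (\<alpha> * (p / 2)) * const_C mu L s) \<longrightarrow>
       (\<forall>s\<in>{0..t}. ereal (Lp_norm p (mu s) (q s)) \<le>
           ereal (exp (- \<alpha> * (t - s))) * ereal_sqrt (2 + inverse (ereal (\<alpha> * \<beta>)))
             * ereal (Lp_norm p (mu t) f)))"
proof (intro conjI allI impI ballI)
  interpret evolving_measures mu Ham L lam by fact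
  interpret propagator mu Ham L lam t f q
    by unfold_locales (use assms in \<open>simp_all add: expectation_finite\<close>)
  {
    fix s
    assume cond: "\<forall>s\<in>{0..t}. ereal (lam s) \<ge> ereal (1 / 2) * const_A mu L s + ereal \<alpha> * const_C mu L s"
      and s: "s \<in> {0..t}"
    have "energy_bound (1 / 2) 0 \<alpha> r" if "r \<in> {0..t}" for r
    proof (rule energy_boundI)
      show "ereal (1 / 2) * const_A mu L r + ereal 0 * const_B mu L r + ereal \<alpha> * const_C mu L r
          \<le> ereal (lam r)"
      proof -
        \<comment> \<open>B may be infinite; the convention \<open>0 * \<infinity> = 0\<close> makes
          its term disappear.\<close>
        have B: "ereal 0 * const_B mu L r = 0"
          unfolding zero_ereal_def[symmetric] by (rule ereal_zero_mult)
        show ?thesis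
          unfolding B add_0_right by (rule bspec[OF cond that])
      qed
    qed (use that \<open>0 \<le> \<alpha>\<close> in auto)
    then show "Lp_norm 2 (mu s) (q s) \<le> exp (- \<alpha> * (t - s)) * Lp_norm 2 (mu t) f"
      using s by (rule L2_norm_decay)
  next
    fix n :: nat and p s :: real
    assume cond: "1 \<le> n \<and> p = 2 ^ n \<and>
       (\<forall>s\<in>{0..t}. ereal (lam s) \<ge> ereal (p / 4) * const_A mu L s
           + ereal (\<beta> * ((p - 1) / 4)) * const_B mu L s + ereal (\<alpha> * (p / 2)) * const_C mu L s)"
      and s: "s \<in> {0..t}"
    obtain j where "n = Suc j"
      using conjunct1[OF cond] by (cases n) auto
    moreover define k :: nat where "k = 2 ^ j"
    ultimately have k: "1 \<le> k" and p: "p = real (2 * k)"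
      using conjunct1[OF conjunct2[OF cond]] by simp_all
    have bound: "energy_bound (p / 4) (\<beta> * ((p - 1) / 4)) (\<alpha> * (p / 2)) r" if "r \<in> {0..t}" for r
    proof (rule energy_boundI)
      show "ereal (p / 4) * const_A mu L r + ereal (\<beta> * ((p - 1) / 4)) * const_B mu L r
          + ereal (\<alpha> * (p / 2)) * const_C mu L r \<le> ereal (lam r)"
        using cond that by blast
    qed (use that \<open>0 \<le> \<alpha>\<close> \<open>0 \<le> \<beta>\<close> k p in auto)
    have bound2: "energy_bound (1 / 2) 0 \<alpha> r" if "r \<in> {0..t}" for r
      using that \<open>0 \<le> \<beta>\<close> k p by (intro energy_bound_2[OF _ _ _ bound]) auto
    show "ereal (Lp_norm p (mu s) (q s)) \<le>
        ereal (exp (- \<alpha> * (t - s))) * ereal_sqrt (2 + inverse (ereal (\<alpha> * \<beta>))) * ereal (Lp_norm p (mu t) f)"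
    proof (cases "\<alpha> * \<beta> = 0")
      case True
      then have "ereal_sqrt (2 + inverse (ereal (\<alpha> * \<beta>))) = \<infinity>"
        by (simp add: ereal_sqrt_def)
      moreover have "Lp_norm p (mu s) (q s) = 0" if "Lp_norm p (mu t) f = 0"
        using propagator_0[OF bound2 s that] k p by simp
      ultimately show ?thesis
        using Lp_norm_nonneg[of p "mu t" f]
        by (cases "Lp_norm p (mu t) f = 0") auto
    next
      case False
      then have pos: "0 < \<alpha>" "0 < \<beta>"
        using \<open>0 \<le> \<alpha>\<close> \<open>0 \<le> \<beta>\<close> by auto
      let ?D = "2 + 1 / (\<alpha> * \<beta>)"
      have "Lp_norm p (mu s) (q s) \<le> exp (- \<alpha> * (t - s)) * sqrt ?D * Lp_norm p (mu t) f"
      proof (cases "k = 1")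
        case True
        have "1 \<le> sqrt ?D"
          using pos by simp
        then have le: "exp (- \<alpha> * (t - s)) * 1 * Lp_norm p (mu t) f
            \<le> exp (- \<alpha> * (t - s)) * sqrt ?D * Lp_norm p (mu t) f"
          by (intro mult_right_mono mult_left_mono Lp_norm_nonneg) auto
        have "Lp_norm p (mu s) (q s) \<le> exp (- \<alpha> * (t - s)) * 1 * Lp_norm p (mu t) f"
          using L2_norm_decay[OF bound2 s] by (simp add: p True)
        then show ?thesis
          using le by (rule order_trans)
      next
        case False
        then have "2 \<le> k" using k by simp
        from even_moment_decay[OF this pos bound[unfolded p] s] show ?thesis
          unfolding p using pos k by (intro Lp_norm_decay) auto
      qed
      moreover have "ereal_sqrt (2 + inverse (ereal (\<alpha> * \<beta>))) = ereal (sqrt ?D)"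
      proof -
        have "2 + inverse (ereal (\<alpha> * \<beta>)) = ereal 2 + ereal (1 / (\<alpha> * \<beta>))"
          using False by (simp add: inverse_eq_divide)
        then show ?thesis
          by (simp add: ereal_sqrt_def)
      qed
      ultimately show ?thesis
        by simp
    qed
  }
qed

end
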